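(* Let $f$ be an increasing probability density on $(0,1)$. Consider a single observation $X$ and testing the hypothesis $H$ that $X$ is uniformly distributed on $(0,1)$ against the two alternatives that $X$ has density $p_1(x)=f(x)$ or density $p_2(x)=f(1-x)$. Then, at level $\alpha$: (i) (a) if $f$ is convex, the average LR test rejects when $|x-\frac12|$ is sufficiently large; (b) if $f$ is concave, the average LR test rejects when $|x-\frac12|$ is sufficiently small. (ii) (a) If $f$ is convex, the maximum LR test coincides with the average LR test, and hence is uniformly most powerful (against both $p_1$ and $p_2$) among all symmetric tests; (b) if $f$ is concave, the maximum LR test uniformly minimizes the power (against both $p_1$ and $p_2$) among all symmetric tests, and therefore has power $<\alpha$.
   Context: A test is given by a rejection region $R\subseteq(0,1)$ and rejects $H$ when $X\in R$; all tests are considered at a common level $\alpha$, and the power of the test against $p_j$ is $\int_R p_j(x)\,dx$. A test is symmetric if $x\in R$ if and only if $1-x\in R$. The average likelihood ratio (LR) test is the test that rejects $H$ when $\frac12[p_1(x)+p_2(x)]$ is sufficiently large. The maximum likelihood ratio (LR) test is the test that rejects $H$ when $\max(p_1(x),p_2(x))$ is sufficiently large.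
   Formalization: In (ii)(b), power < α is claimed only when f is not affine on (0,1) (for f(x)=2x every symmetric test has power exactly α); for affine f, power ≤ α. Where the average LR has ties at its critical value, "coincides" leaves the decision on the tie set free. *)

theory Defs
  imports "HOL-Probability.Probability"
begin

abbreviation I01 :: "real set" where
  "I01 \<equiv> {0<..<1}"

definition density_on_I01 :: "(real \<Rightarrow> real) \<Rightarrow> bool" where
  "density_on_I01 f \<longleftrightarrow>
     (\<forall>x\<in>I01. 0 \<le> f x) \<and> set_integrable lborel I01 f \<and> (LINT x:I01|lborel. f x) = 1"

definition p1 :: "(real \<Rightarrow> real) \<Rightarrow> real \<Rightarrow> real" where
  "p1 f x = f x"

definition p2 :: "(real \<Rightarrow> real) \<Rightarrow> real \<Rightarrow> real" where
  "p2 f x = f (1 - x)"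

text \<open>The level of a test is its exact rejection probability under the uniform distribution.
  (With ``at most \<alpha>'' the empty region would be the symmetric test of minimal power.)\<close>

definition level_test :: "real \<Rightarrow> real set \<Rightarrow> bool" where
  "level_test \<alpha> R \<longleftrightarrow>
     R \<subseteq> I01 \<and> R \<in> sets borel \<and> measure (uniform_measure lborel I01) R = \<alpha>"

definition power_against :: "(real \<Rightarrow> real) \<Rightarrow> real set \<Rightarrow> real" where
  "power_against p R = (LINT x:R|lborel. p x)"

definition symmetric_region :: "real set \<Rightarrow> bool" where
  "symmetric_region R \<longleftrightarrow> (\<forall>x\<in>I01. x \<in> R \<longleftrightarrow> 1 - x \<in> R)"

definition most_powerful_symmetric :: "real \<Rightarrow> (real \<Rightarrow> real) \<Rightarrow> real set \<Rightarrow> bool" where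
  "most_powerful_symmetric \<alpha> p R \<longleftrightarrow>
     level_test \<alpha> R \<and> symmetric_region R \<and>
     (\<forall>S. level_test \<alpha> S \<and> symmetric_region S \<longrightarrow> power_against p S \<le> power_against p R)"

definition least_powerful_symmetric :: "real \<Rightarrow> (real \<Rightarrow> real) \<Rightarrow> real set \<Rightarrow> bool" where
  "least_powerful_symmetric \<alpha> p R \<longleftrightarrow>
     level_test \<alpha> R \<and> symmetric_region R \<and>
     (\<forall>S. level_test \<alpha> S \<and> symmetric_region S \<longrightarrow> power_against p R \<le> power_against p S)"

text \<open>\<open>R\<close> is the level-\<open>\<alpha>\<close> test that rejects exactly when \<open>T x\<close> is sufficiently large.\<close>

definition rejects_when_large :: "real \<Rightarrow> (real \<Rightarrow> real) \<Rightarrow> real set \<Rightarrow> bool" where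
  "rejects_when_large \<alpha> T R \<longleftrightarrow>
     level_test \<alpha> R \<and> (\<exists>c. R = {x \<in> I01. T x > c} \<or> R = {x \<in> I01. T x \<ge> c})"

text \<open>The Neyman-Pearson form: reject for \<open>T x > c\<close>, accept for \<open>T x < c\<close>, decide arbitrarily on
  \<open>T x = c\<close>.  The two notions differ only if \<open>T\<close> takes its critical value with positive
  probability; then a region of the first kind need not exist at the given level.  For the average
  likelihood ratio this does happen: it is constant if \<open>f x = 2 * x\<close>.\<close>

definition rejects_when_large_ties :: "real \<Rightarrow> (real \<Rightarrow> real) \<Rightarrow> real set \<Rightarrow> bool" where
  "rejects_when_large_ties \<alpha> T R \<longleftrightarrow>
     level_test \<alpha> R \<and> (\<exists>c. \<forall>x\<in>I01. (T x > c \<longrightarrow> x \<in> R) \<and> (T x < c \<longrightarrow> x \<notin> R))"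

definition avg_LR :: "(real \<Rightarrow> real) \<Rightarrow> real \<Rightarrow> real" where
  "avg_LR f x = (1/2) * (p1 f x + p2 f x)"

definition max_LR :: "(real \<Rightarrow> real) \<Rightarrow> real \<Rightarrow> real" where
  "max_LR f x = max (p1 f x) (p2 f x)"

definition avg_LR_test :: "real \<Rightarrow> (real \<Rightarrow> real) \<Rightarrow> real set \<Rightarrow> bool" where
  "avg_LR_test \<alpha> f = rejects_when_large \<alpha> (avg_LR f)"

definition avg_LR_test_ties :: "real \<Rightarrow> (real \<Rightarrow> real) \<Rightarrow> real set \<Rightarrow> bool" where
  "avg_LR_test_ties \<alpha> f = rejects_when_large_ties \<alpha> (avg_LR f)"

definition max_LR_test :: "real \<Rightarrow> (real \<Rightarrow> real) \<Rightarrow> real set \<Rightarrow> bool" where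
  "max_LR_test \<alpha> f = rejects_when_large \<alpha> (max_LR f)"

definition large_distance_test :: "real \<Rightarrow> real set \<Rightarrow> bool" where
  "large_distance_test \<alpha> = rejects_when_large \<alpha> (\<lambda>x. \<bar>x - 1/2\<bar>)"

definition small_distance_test :: "real \<Rightarrow> real set \<Rightarrow> bool" where
  "small_distance_test \<alpha> = rejects_when_large \<alpha> (\<lambda>x. - \<bar>x - 1/2\<bar>)"

definition affine_on_I01 :: "(real \<Rightarrow> real) \<Rightarrow> bool" where
  "affine_on_I01 f \<longleftrightarrow> (\<exists>a b. \<forall>x\<in>I01. f x = a * x + b)"

text \<open>For strictly increasing \<open>f\<close> the maximum likelihood ratio has no ties of positive probability,
  so the maximum likelihood ratio test exists at every level.\<close>

lemma max_LR_test_exists: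
  assumes f: "strict_mono_on I01 f" and \<alpha>: "0 < \<alpha>" "\<alpha> < 1"
  shows "\<exists>R. max_LR_test \<alpha> f R"
proof -
  define R where "R = {x \<in> I01. max_LR f x > f (1 - \<alpha>/2)}"
  have R: "R = {0<..<\<alpha>/2} \<union> {1-\<alpha>/2<..<1}"
  proof -
    have less: "f y < f x \<longleftrightarrow> y < x" if "x \<in> I01" "y \<in> I01" for x y
      using f that unfolding strict_mono_on_def by (metis less_asym linorder_neqE_linordered_idom)
    have "max_LR f x > f (1 - \<alpha>/2) \<longleftrightarrow> x < \<alpha>/2 \<or> 1 - \<alpha>/2 < x" if "x \<in> I01" for x
      using less[of x "1 - \<alpha>/2"] less[of "1 - x" "1 - \<alpha>/2"] that \<alpha>
      by (auto simp: max_LR_def p1_def p2_def less_max_iff_disj)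
    thus ?thesis using \<alpha> by (auto simp: R_def)
  qed
  have b: "R \<in> sets borel" "R \<subseteq> I01" unfolding R using \<alpha> by auto
  have "measure lborel R = \<alpha>/2 + \<alpha>/2"
    unfolding R using \<alpha> by (subst measure_Union) auto
  hence "measure (uniform_measure lborel I01) R = \<alpha>"
    using b by (subst measure_uniform_measure) (auto simp: Int_absorb1)
  thus ?thesis using b
    unfolding max_LR_test_def rejects_when_large_def level_test_def
    by (intro exI[of _ R]) (auto simp: R_def)
qed

end

theory Submission
  imports Defs
begin

text \<open>Both likelihood ratios are symmetric about \<open>1/2\<close>. For convex \<open>f\<close> the average is a convex
  symmetric function, hence nondecreasing in \<open>\<bar>x - 1/2\<bar>\<close> (nonincreasing for concave \<open>f\<close>), while
  monotonicity of \<open>f\<close> alone makes the maximum nondecreasing in \<open>\<bar>x - 1/2\<bar>\<close>. Each test is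
  characterised by the order in which its statistic ranks the points of the region and of its
  complement, so the coincidences reduce to pointwise comparisons of the statistics. A symmetric
  test has the same power against \<open>p1\<close>, \<open>p2\<close> and their average, so the optimality claims follow
  from the Neyman-Pearson lemma for the average; comparing with the randomised test that always
  rejects with probability \<open>\<alpha>\<close> bounds the power by \<open>\<alpha>\<close>. Equality there makes the average
  constant, so that \<open>f\<close> is convex as well as concave.\<close>

section \<open>Threshold tests\<close>

lemma level_test_measure:
  assumes "level_test \<alpha> R"
  shows "R \<subseteq> I01" "R \<in> sets borel" "measure lborel R = \<alpha>"
proof -
  show R: "R \<subseteq> I01" "R \<in> sets borel"
    using assms by (auto simp: level_test_def)
  have "measure (uniform_measure lborel I01) R = measure lborel R"
    using R by (subst measure_uniform_measure) (auto simp: Int_absorb1)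
  thus "measure lborel R = \<alpha>"
    using assms by (simp add: level_test_def)
qed

lemma level_test_nontrivial:
  assumes "level_test \<alpha> R" "0 < \<alpha>" "\<alpha> < 1"
  obtains x y where "x \<in> I01 - R" "y \<in> R"
proof -
  have "R \<noteq> {}" "R \<noteq> I01"
    using level_test_measure[OF assms(1)] assms(2,3) by auto
  thus ?thesis
    using that level_test_measure(1)[OF assms(1)] by blast
qed

text \<open>Removes the existential threshold: the infimum of \<open>T\<close> over \<open>R\<close>
  always serves as one. Tests built from different statistics can then be compared through the order
  on points alone.\<close>

lemma rejects_when_large_iff:
  assumes R: "level_test \<alpha> R" and \<alpha>: "0 < \<alpha>" "\<alpha> < 1"
  shows "rejects_when_large \<alpha> T R \<longleftrightarrow> (\<forall>x\<in>I01 - R. \<forall>y\<in>R. T x < T y)"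
proof
  assume "rejects_when_large \<alpha> T R"
  thus "\<forall>x\<in>I01 - R. \<forall>y\<in>R. T x < T y"
    by (fastforce simp: rejects_when_large_def)
next
  assume lt: "\<forall>x\<in>I01 - R. \<forall>y\<in>R. T x < T y"
  obtain u v where u: "u \<in> I01 - R" and v: "v \<in> R"
    using level_test_nontrivial[OF R \<alpha>] .
  note sub = level_test_measure(1)[OF R]
  define c where "c = Inf (T ` R)"
  have bdd: "bdd_below (T ` R)"
    using lt u by (auto intro!: bdd_belowI[of _ "T u"] less_imp_le)
  have ge: "c \<le> T y" if "y \<in> R" for y
    unfolding c_def using bdd that by (intro cInf_lower) auto
  have le: "T x \<le> c" if "x \<in> I01 - R" for x
    unfolding c_def using lt v that by (intro cInf_greatest) (auto intro: less_imp_le)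
  \<comment> \<open>Whether the infimum is attained decides the form of the region: if it is, the
    complement lies strictly below \<open>c\<close>; if not, \<open>R\<close> lies strictly above
    it.\<close>
  have "R = {x \<in> I01. T x > c} \<or> R = {x \<in> I01. T x \<ge> c}"
  proof (cases "c \<in> T ` R")
    case True
    have "T x < c" if "x \<in> I01 - R" for x
      using True lt that by auto
    hence "R = {x \<in> I01. T x \<ge> c}"
      using ge sub by force
    thus ?thesis ..
  next
    case False
    have "T x > c" if "x \<in> R" for x
      using False ge[OF that] that by (auto simp: less_le)
    hence "R = {x \<in> I01. T x > c}"
      using le sub by force
    thus ?thesis ..
  qed
  thus "rejects_when_large \<alpha> T R"
    using R by (auto simp: rejects_when_large_def)
qed

text \<open>The same infimum is a critical value, and since ties may be decided freely, it does not
  matter whether it is attained.\<close>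

lemma rejects_when_large_ties_iff:
  assumes R: "level_test \<alpha> R" and \<alpha>: "0 < \<alpha>" "\<alpha> < 1"
  shows "rejects_when_large_ties \<alpha> T R \<longleftrightarrow> (\<forall>x\<in>I01 - R. \<forall>y\<in>R. T x \<le> T y)"
proof
  assume "rejects_when_large_ties \<alpha> T R"
  then obtain c where c: "\<forall>x\<in>I01. (T x > c \<longrightarrow> x \<in> R) \<and> (T x < c \<longrightarrow> x \<notin> R)"
    by (auto simp: rejects_when_large_ties_def)
  thus "\<forall>x\<in>I01 - R. \<forall>y\<in>R. T x \<le> T y"
    using level_test_measure(1)[OF R] by (meson DiffE linorder_not_le order_trans subsetD)
next
  assume le: "\<forall>x\<in>I01 - R. \<forall>y\<in>R. T x \<le> T y"
  obtain u v where u: "u \<in> I01 - R" and v: "v \<in> R"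
    using level_test_nontrivial[OF R \<alpha>] .
  have bdd: "bdd_below (T ` R)"
    using le u by (auto intro!: bdd_belowI[of _ "T u"])
  have "Inf (T ` R) \<le> T y" if "y \<in> R" for y
    using bdd that by (intro cInf_lower) auto
  moreover have "T x \<le> Inf (T ` R)" if "x \<in> I01 - R" for x
    using le v that by (intro cInf_greatest) auto
  ultimately show "rejects_when_large_ties \<alpha> T R"
    unfolding rejects_when_large_ties_def using R
    by (intro conjI exI[of _ "Inf (T ` R)"]) force+
qed

text \<open>Only pairs of an accepted and a rejected point matter, and \<open>T\<close> orders these
  strictly. The cutoff for \<open>U\<close> may be unrelated to the one for
  \<open>T\<close>.\<close>

lemma rejects_when_large_mono:
  assumes "rejects_when_large \<alpha> T R" "0 < \<alpha>" "\<alpha> < 1"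
    and "\<And>x y. x \<in> I01 \<Longrightarrow> y \<in> I01 \<Longrightarrow> T x < T y \<Longrightarrow> U x < U y"
  shows "rejects_when_large \<alpha> U R"
proof -
  have R: "level_test \<alpha> R"
    using assms(1) by (simp add: rejects_when_large_def)
  show ?thesis
    using assms level_test_measure(1)[OF R] unfolding rejects_when_large_iff[OF R assms(2,3)]
    by blast
qed

text \<open>Here \<open>U\<close> may be constant where \<open>T\<close> still separates points, so
  only the Neyman-Pearson form carries over.\<close>

lemma rejects_when_large_imp_ties:
  assumes "rejects_when_large \<alpha> T R" "0 < \<alpha>" "\<alpha> < 1"
    and "\<And>x y. x \<in> I01 \<Longrightarrow> y \<in> I01 \<Longrightarrow> T x < T y \<Longrightarrow> U x \<le> U y"
  shows "rejects_when_large_ties \<alpha> U R"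
proof -
  have R: "level_test \<alpha> R"
    using assms(1) by (simp add: rejects_when_large_def)
  show ?thesis
    using assms level_test_measure(1)[OF R]
    unfolding rejects_when_large_iff[OF R assms(2,3)] rejects_when_large_ties_iff[OF R assms(2,3)]
    by blast
qed

section \<open>The Neyman-Pearson lemma\<close>

lemma set_integrable_mult_bounded:
  fixes h T :: "'a \<Rightarrow> real"
  assumes T: "set_integrable M A T" and h: "h \<in> borel_measurable M"
    and bound: "\<And>x. x \<in> A \<Longrightarrow> \<bar>h x\<bar> \<le> 1"
  shows "set_integrable M A (\<lambda>x. h x * T x)"
proof -
  have int: "integrable M (\<lambda>x. indicator A x * T x)"
    using T by (simp add: set_integrable_def)
  have "integrable M (\<lambda>x. h x * (indicator A x * T x))"
  proof (rule Bochner_Integration.integrable_bound[OF int])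
    show "(\<lambda>x. h x * (indicator A x * T x)) \<in> borel_measurable M"
      using h int by measurable
    show "AE x in M. norm (h x * (indicator A x * T x)) \<le> norm (indicator A x * T x)"
      using bound by (intro AE_I2) (auto simp: indicator_def abs_mult intro: mult_left_le_one_le)
  qed
  thus ?thesis
    by (simp add: set_integrable_def mult.left_commute)
qed

text \<open>\<phi> is the critical function of a possibly randomised competitor. Integrating
  \<open>(indicator R x - \<phi> x) * (T x - c)\<close> gives the difference of the two sides, since
  the terms with \<open>c\<close> cancel at equal level. The integrand is nonnegative, so equality
  forces it to vanish almost everywhere.\<close>

lemma neyman_pearson:
  fixes T \<phi> :: "real \<Rightarrow> real"
  assumes R: "level_test \<alpha> R" and T: "set_integrable lborel I01 T"
    and ge: "\<And>x. x \<in> R \<Longrightarrow> c \<le> T x" and le: "\<And>x. x \<in> I01 - R \<Longrightarrow> T x \<le> c"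
    and \<phi>: "\<phi> \<in> borel_measurable borel" "\<And>x. x \<in> I01 \<Longrightarrow> 0 \<le> \<phi> x \<and> \<phi> x \<le> 1"
    and level: "(LINT x:I01|lborel. \<phi> x) = \<alpha>"
  shows "(LINT x:I01|lborel. \<phi> x * T x) \<le> (LINT x:R|lborel. T x)"
    and "(LINT x:I01|lborel. \<phi> x * T x) = (LINT x:R|lborel. T x) \<Longrightarrow>
      AE x in lborel. x \<in> I01 \<longrightarrow> (indicator R x - \<phi> x) * (T x - c) = 0"
proof -
  note Rm = level_test_measure[OF R]
  have [measurable]: "R \<in> sets borel" "\<phi> \<in> borel_measurable borel"
    using Rm \<phi> by auto
  have one: "set_integrable lborel I01 (\<lambda>x. 1::real)"
    by (simp add: set_integrable_def)
  have i1: "set_integrable lborel I01 (\<lambda>x. indicator R x * T x)"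
    by (rule set_integrable_mult_bounded[OF T]) (auto simp: indicator_def)
  have i2: "set_integrable lborel I01 (\<lambda>x. \<phi> x * T x)"
    by (rule set_integrable_mult_bounded[OF T]) (use \<phi> in auto)
  have i3: "set_integrable lborel I01 (\<lambda>x. indicator R x :: real)"
    using set_integrable_mult_bounded[OF one, of "indicator R"] by (auto simp: indicator_def)
  have i4: "set_integrable lborel I01 \<phi>"
    using set_integrable_mult_bounded[OF one, of \<phi>] \<phi> by auto
  define g where "g x = (indicator R x - \<phi> x) * (T x - c)" for x
  have g_eq: "g = (\<lambda>x. (indicator R x * T x - \<phi> x * T x) - (c * indicator R x - c * \<phi> x))"
    by (auto simp: g_def algebra_simps)
  have g_int: "set_integrable lborel I01 g"
    unfolding g_eq using i1 i2 i3 i4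
    by (intro set_integral_diff set_integrable_mult_right) auto
  have e1: "(LINT x:I01|lborel. indicator R x * T x) = (LINT x:R|lborel. T x)"
    unfolding set_lebesgue_integral_def using Rm(1)
    by (intro Bochner_Integration.integral_cong) (auto simp: indicator_def)
  have "(LINT x:I01|lborel. indicator R x :: real) = (LINT x|lborel. indicator R x)"
    unfolding set_lebesgue_integral_def using Rm(1)
    by (intro Bochner_Integration.integral_cong) (auto simp: indicator_def)
  also have "\<dots> = \<alpha>"
    using Rm by simp
  finally have e2: "(LINT x:I01|lborel. indicator R x :: real) = \<alpha>" .
  have gval: "(LINT x:I01|lborel. g x) = (LINT x:R|lborel. T x) - (LINT x:I01|lborel. \<phi> x * T x)"
    unfolding g_eq using i1 i2 i3 i4 e1 e2 level by simp
  \<comment> \<open>Both factors of \<open>g\<close> are nonnegative on \<open>R\<close> and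
    nonpositive on the rest of the interval.\<close>
  have pos: "0 \<le> indicator I01 x * g x" for x
  proof (cases "x \<in> I01")
    case True
    thus ?thesis
      using ge[of x] le[of x] \<phi>(2)[of x]
      by (cases "x \<in> R") (auto simp: g_def intro: mult_nonneg_nonpos mult_nonneg_nonneg
          split_mult_pos_le)
  qed simp
  have "0 \<le> (LINT x:I01|lborel. g x)"
    unfolding set_lebesgue_integral_def using pos by (intro integral_nonneg_AE) auto
  thus "(LINT x:I01|lborel. \<phi> x * T x) \<le> (LINT x:R|lborel. T x)"
    using gval by simp
  assume "(LINT x:I01|lborel. \<phi> x * T x) = (LINT x:R|lborel. T x)"
  hence "(LINT x|lborel. indicator I01 x * g x) = 0"
    using gval by (simp add: set_lebesgue_integral_def)
  hence "AE x in lborel. indicator I01 x * g x = 0"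
    using g_int pos integral_nonneg_eq_0_iff_AE[of lborel "\<lambda>x. indicator I01 x * g x"]
    by (simp add: set_integrable_def)
  thus "AE x in lborel. x \<in> I01 \<longrightarrow> (indicator R x - \<phi> x) * (T x - c) = 0"
    by (rule eventually_mono) (auto simp: g_def)
qed

text \<open>The nonrandomised competitor \<open>S\<close> has the critical function
  \<open>indicator S\<close>.\<close>

lemma rejects_when_large_ties_optimal:
  fixes T :: "real \<Rightarrow> real"
  assumes R: "rejects_when_large_ties \<alpha> T R" and T: "set_integrable lborel I01 T"
    and \<alpha>: "0 < \<alpha>" "\<alpha> < 1" and S: "level_test \<alpha> S"
  shows "(LINT x:S|lborel. T x) \<le> (LINT x:R|lborel. T x)"
proof -
  obtain c where c: "\<forall>x\<in>I01. (T x > c \<longrightarrow> x \<in> R) \<and> (T x < c \<longrightarrow> x \<notin> R)"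
    using R by (auto simp: rejects_when_large_ties_def)
  have Rl: "level_test \<alpha> R"
    using R by (simp add: rejects_when_large_ties_def)
  note Sm = level_test_measure[OF S]
  have [measurable]: "S \<in> sets borel"
    using Sm by auto
  have "(LINT x:I01|lborel. indicator S x :: real) = (LINT x|lborel. indicator S x)"
    unfolding set_lebesgue_integral_def using Sm(1)
    by (intro Bochner_Integration.integral_cong) (auto simp: indicator_def)
  hence "(LINT x:I01|lborel. indicator S x :: real) = \<alpha>"
    using Sm by simp
  moreover have "c \<le> T x" if "x \<in> R" for x
    using c that level_test_measure(1)[OF Rl] by (meson linorder_not_le subsetD)
  moreover have "T x \<le> c" if "x \<in> I01 - R" for x
    using c that by (meson DiffE linorder_not_le)
  ultimately have "(LINT x:I01|lborel. indicator S x * T x) \<le> (LINT x:R|lborel. T x)"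
    by (intro neyman_pearson(1)[OF Rl T]) auto
  also have "(LINT x:I01|lborel. indicator S x * T x) = (LINT x:S|lborel. T x)"
    unfolding set_lebesgue_integral_def using Sm(1)
    by (intro Bochner_Integration.integral_cong) (auto simp: indicator_def)
  finally show ?thesis .
qed

section \<open>Likelihood ratios as functions of the distance to the centre\<close>

text \<open>A point \<open>y\<close> no farther from the centre than \<open>x\<close> lies between
  \<open>x\<close> and \<open>1 - x\<close>. Convexity bounds \<open>f\<close> at \<open>y\<close>
  and at \<open>1 - y\<close> with the two weights interchanged, so the weights disappear on
  adding.\<close>

lemma avg_LR_mono_distance:
  assumes f: "convex_on I01 f" and "x \<in> I01" "y \<in> I01" and d: "\<bar>y - 1/2\<bar> \<le> \<bar>x - 1/2\<bar>"
  shows "avg_LR f y \<le> avg_LR f x"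
proof (cases "x = 1/2")
  case True
  hence "y = x" using d by auto
  thus ?thesis by simp
next
  case False
  \<comment> \<open>The relative position of \<open>y\<close> on the segment from \<open>x\<close>
    to \<open>1 - x\<close>, which degenerates exactly in the excluded case.\<close>
  define t where "t = (y - x) / (1 - 2 * x)"
  have nz: "1 - 2 * x \<noteq> 0"
    using False by auto
  have t: "0 \<le> t" "t \<le> 1"
    using d False by (auto simp: t_def field_simps abs_if split: if_splits)
  have "t * (1 - 2 * x) = y - x"
    using nz by (simp add: t_def)
  hence y: "y = (1 - t) * x + t * (1 - x)" and y': "1 - y = (1 - t) * (1 - x) + t * x"
    by (auto simp: algebra_simps)
  have "f y \<le> (1 - t) * f x + t * f (1 - x)"
    using convex_onD[OF f t, of x "1 - x"] assms(2) by (subst y) simp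
  moreover have "f (1 - y) \<le> (1 - t) * f (1 - x) + t * f x"
    using convex_onD[OF f t, of "1 - x" x] assms(2) by (subst y') simp
  ultimately show ?thesis
    by (simp add: avg_LR_def p1_def p2_def algebra_simps)
qed

lemma avg_LR_uminus: "avg_LR (\<lambda>x. - f x) x = - avg_LR f x"
  by (simp add: avg_LR_def p1_def p2_def field_simps)

lemma avg_LR_antimono_distance:
  assumes "concave_on I01 f" "x \<in> I01" "y \<in> I01" "\<bar>y - 1/2\<bar> \<le> \<bar>x - 1/2\<bar>"
  shows "avg_LR f x \<le> avg_LR f y"
  using avg_LR_mono_distance[of "\<lambda>x. - f x" x y] assms
  by (simp add: concave_on_def avg_LR_uminus)

text \<open>By monotonicity the larger value is taken at the larger of \<open>x\<close> and
  \<open>1 - x\<close>.\<close>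

lemma max_LR_eq:
  assumes "mono_on I01 f" "x \<in> I01"
  shows "max_LR f x = f (1/2 + \<bar>x - 1/2\<bar>)"
proof (cases "x \<le> 1/2")
  case True
  hence "f x \<le> f (1 - x)"
    using assms by (intro mono_onD[OF assms(1)]) auto
  thus ?thesis using True by (simp add: max_LR_def p1_def p2_def)
next
  case False
  hence "f (1 - x) \<le> f x"
    using assms by (intro mono_onD[OF assms(1)]) auto
  thus ?thesis using False by (simp add: max_LR_def p1_def p2_def)
qed

lemma max_LR_mono_distance:
  assumes "mono_on I01 f" "x \<in> I01" "y \<in> I01" "\<bar>y - 1/2\<bar> \<le> \<bar>x - 1/2\<bar>"
  shows "max_LR f y \<le> max_LR f x"
proof -
  have "1/2 + \<bar>x - 1/2\<bar> \<in> I01" "1/2 + \<bar>y - 1/2\<bar> \<in> I01"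
    using assms by (auto simp: abs_if)
  thus ?thesis
    using assms mono_onD[OF assms(1), of "1/2 + \<bar>y - 1/2\<bar>" "1/2 + \<bar>x - 1/2\<bar>"]
    by (simp add: max_LR_eq)
qed

text \<open>The slopes of a convex function do not decrease, so a nondecreasing one that is flat
  from \<open>u\<close> to \<open>v\<close> cannot have risen before \<open>u\<close>.\<close>

lemma convex_mono_const_left:
  fixes f :: "real \<Rightarrow> real"
  assumes f: "convex_on A f" "mono_on A f" and A: "w \<in> A" "u \<in> A" "v \<in> A"
    and uv: "u < v" "f u = f v" and w: "w \<le> v"
  shows "f w = f v"
proof (cases "w < u")
  case False
  thus ?thesis
    using mono_onD[OF f(2), of u w] mono_onD[OF f(2), of w v] A uv w by simp
next
  case True
  define t where "t = (u - w) / (v - w)"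
  have t: "0 < t" "t < 1"
    using True uv by (auto simp: t_def)
  have "t * (v - w) = u - w"
    using True uv by (simp add: t_def)
  hence "u = (1 - t) * w + t * v"
    by (simp add: algebra_simps)
  hence "f u \<le> (1 - t) * f w + t * f v"
    using convex_onD[OF f(1), of t w v] t A by simp
  hence "(1 - t) * f v \<le> (1 - t) * f w"
    using uv by (simp add: algebra_simps)
  hence "f v \<le> f w"
    using t by simp
  moreover have "f w \<le> f v"
    using mono_onD[OF f(2)] A w by simp
  ultimately show ?thesis by simp
qed

text \<open>This makes the coincidence of the two tests strict. Were the maximum not to increase,
  \<open>f\<close> would be flat between the two reflected points \<open>u\<close> and
  \<open>v\<close>, hence on everything up to \<open>v\<close>, and the averages would
  agree.\<close>

lemma max_LR_less_if_avg_LR_less: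
  assumes f: "convex_on I01 f" "mono_on I01 f" and xy: "x \<in> I01" "y \<in> I01"
    and less: "avg_LR f x < avg_LR f y"
  shows "max_LR f x < max_LR f y"
proof (rule ccontr)
  define u v where "u = 1/2 + \<bar>x - 1/2\<bar>" and "v = 1/2 + \<bar>y - 1/2\<bar>"
  assume "\<not> max_LR f x < max_LR f y"
  hence "f v \<le> f u"
    using max_LR_eq[OF f(2)] xy by (simp add: u_def v_def)
  have uv: "u < v"
    using avg_LR_mono_distance[OF f(1) xy] less by (force simp: u_def v_def)
  have I: "u \<in> I01" "v \<in> I01"
    using xy by (auto simp: u_def v_def abs_if)
  have "f u = f v"
    using mono_onD[OF f(2) I] uv \<open>f v \<le> f u\<close> by simp
  hence const: "f w = f v" if "w \<in> I01" "w \<le> v" for w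
    using convex_mono_const_left[OF f that(1) I uv] that by simp
  \<comment> \<open>All four arguments entering the two averages lie in the flat stretch.\<close>
  have "x \<le> v" "1 - x \<le> v" "y \<le> v" "1 - y \<le> v"
    using uv by (auto simp: u_def v_def abs_if split: if_splits)
  hence "avg_LR f x = avg_LR f y"
    using xy by (simp add: avg_LR_def p1_def p2_def const)
  thus False using less by simp
qed

section \<open>Power of symmetric tests\<close>

lemma lborel_reflect:
  fixes g :: "real \<Rightarrow> real"
  assumes "integrable lborel g"
  shows "integrable lborel (\<lambda>x. g (1 - x))" "(LINT x|lborel. g (1 - x)) = (LINT x|lborel. g x)"
  using lborel_integrable_real_affine[OF assms, of "-1" 1] lborel_integral_real_affine[of "-1" g 1]
  by simp_all

lemma set_integrable_avg_LR:
  assumes "density_on_I01 f"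
  shows "set_integrable lborel I01 (p1 f)" "set_integrable lborel I01 (p2 f)"
    "set_integrable lborel I01 (avg_LR f)"
proof -
  have f: "integrable lborel (\<lambda>x. indicator I01 x * f x)"
    using assms by (simp add: density_on_I01_def set_integrable_def)
  show 1: "set_integrable lborel I01 (p1 f)"
    using f by (simp add: set_integrable_def p1_def)
  have "indicator I01 (1 - x) = (indicator I01 x :: real)" for x :: real
    by (auto simp: indicator_def)
  thus 2: "set_integrable lborel I01 (p2 f)"
    using lborel_reflect(1)[OF f] by (simp add: set_integrable_def p2_def)
  show "set_integrable lborel I01 (avg_LR f)"
    unfolding avg_LR_def[abs_def]
    by (intro set_integrable_mult_right set_integral_add(1)[OF 1 2])
qed

text \<open>Reflection at the centre preserves \<open>S\<close> and exchanges the two densities, so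
  both powers equal their mean. Optimality against each alternative thus reduces to optimality for
  the average.\<close>

lemma power_symmetric:
  assumes f: "density_on_I01 f" and S: "S \<subseteq> I01" "S \<in> sets borel" "symmetric_region S"
  shows "power_against (p1 f) S = (LINT x:S|lborel. avg_LR f x)"
    "power_against (p2 f) S = (LINT x:S|lborel. avg_LR f x)"
proof -
  have int: "set_integrable lborel S (p1 f)" "set_integrable lborel S (p2 f)"
    using set_integrable_subset[OF set_integrable_avg_LR(1)[OF f]]
      set_integrable_subset[OF set_integrable_avg_LR(2)[OF f]] S by auto
  \<comment> \<open>\<open>symmetric_region\<close> constrains only points of the interval; outside
    it, reflection stays outside and both indicators vanish.\<close>
  have sym: "indicator S (1 - x) = (indicator S x :: real)" for x
  proof (cases "x \<in> I01")
    case True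
    hence "x \<in> S \<longleftrightarrow> 1 - x \<in> S" using S(3) unfolding symmetric_region_def by blast
    thus ?thesis by (simp add: indicator_def)
  next
    case False
    hence "1 - x \<notin> I01" by auto
    thus ?thesis using S(1) False by (auto simp: indicator_def)
  qed
  have eq: "(LINT x:S|lborel. p1 f x) = (LINT x:S|lborel. p2 f x)"
    using lborel_reflect(2)[of "\<lambda>x. indicator S x * f x"] int(1)
    by (simp add: sym set_lebesgue_integral_def set_integrable_def p1_def p2_def)
  have "(LINT x:S|lborel. avg_LR f x)
      = 1/2 * ((LINT x:S|lborel. p1 f x) + (LINT x:S|lborel. p2 f x))"
    using set_integral_add(2)[OF int] by (simp add: avg_LR_def[abs_def])
  thus "power_against (p1 f) S = (LINT x:S|lborel. avg_LR f x)"
    "power_against (p2 f) S = (LINT x:S|lborel. avg_LR f x)"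
    using eq by (simp_all add: power_against_def)
qed

text \<open>The whole interval is a symmetric region of power 1.\<close>

lemma integral_avg_LR:
  assumes "density_on_I01 f"
  shows "(LINT x:I01|lborel. avg_LR f x) = 1"
  using power_symmetric(1)[OF assms, of I01] assms
  by (auto simp: symmetric_region_def power_against_def p1_def density_on_I01_def)

lemma max_LR_test_symmetric:
  assumes "max_LR_test \<alpha> f R"
  shows "level_test \<alpha> R" "symmetric_region R"
  using assms
  by (auto simp: max_LR_test_def rejects_when_large_def symmetric_region_def max_LR_def p1_def
      p2_def max.commute)

section \<open>The case of equality\<close>

lemma affine_if_convex_concave:
  assumes f: "convex_on I01 f" "concave_on I01 f"
  shows "affine_on_I01 f"
proof -
  \<comment> \<open>Convexity and concavity together give equality on every chord, stated here
    without denominators.\<close>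
  have chord: "(w - u) * f v = (w - v) * f u + (v - u) * f w"
    if "u \<in> I01" "w \<in> I01" "u \<le> v" "v \<le> w" "u < w" for u v w
  proof -
    define t where "t = (v - u) / (w - u)"
    have t: "0 \<le> t" "t \<le> 1" and tw: "t * (w - u) = v - u"
      using that by (auto simp: t_def)
    have v: "v = (1 - t) * u + t * w"
      using tw by (simp add: algebra_simps)
    have "f v = (1 - t) * f u + t * f w"
      using convex_onD[OF f(1) t that(1,2)] concave_onD[OF f(2) t that(1,2)] v by simp
    hence "(w - u) * f v = (w - u) * ((1 - t) * f u + t * f w)"
      by simp
    also have "\<dots> = ((w - u) - t * (w - u)) * f u + (t * (w - u)) * f w"
      by (simp add: algebra_simps)
    finally show ?thesis by (simp add: tw)
  qed
  \<comment> \<open>This is the line through the graph at 1/4 and 3/4; the cases tell which of these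
    two points and \<open>x\<close> is in the middle.\<close>
  have "f x = (2 * (f (3/4) - f (1/4))) * x + (3/2 * f (1/4) - 1/2 * f (3/4))"
    if "x \<in> I01" for x
  proof -
    consider "x < 1/4" | "1/4 \<le> x" "x \<le> 3/4" | "3/4 < x" by linarith
    thus ?thesis
    proof cases
      case 1
      thus ?thesis using chord[of x "3/4" "1/4"] that by (simp add: algebra_simps)
    next
      case 2
      thus ?thesis using chord[of "1/4" "3/4" x] that by (simp add: algebra_simps)
    next
      case 3
      thus ?thesis using chord[of "1/4" x "3/4"] that by (simp add: algebra_simps)
    qed
  qed
  thus ?thesis
    unfolding affine_on_I01_def by blast
qed

lemma convex_on_reflect:
  fixes g :: "real \<Rightarrow> real"
  assumes "convex_on I01 g"
  shows "convex_on I01 (\<lambda>x. g (1 - x))"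
proof (rule convex_onI)
  fix t x y :: real
  assume t: "0 < t" "t < 1" and xy: "x \<in> I01" "y \<in> I01"
  have "1 - ((1 - t) * x + t * y) = (1 - t) * (1 - x) + t * (1 - y)"
    by (simp add: algebra_simps)
  thus "g (1 - ((1 - t) *\<^sub>R x + t *\<^sub>R y)) \<le> (1 - t) * g (1 - x) + t * g (1 - y)"
    using convex_onD[OF assms, of t "1 - x" "1 - y"] t xy by simp
qed (rule convex_real_interval)

text \<open>A constant average gives \<open>f x = 2 * c - f (1 - x)\<close>, and the right side is
  convex when \<open>f\<close> is concave.\<close>

lemma affine_if_avg_LR_const:
  assumes f: "concave_on I01 f" and c: "\<And>x. x \<in> I01 \<Longrightarrow> avg_LR f x = c"
  shows "affine_on_I01 f"
proof (rule affine_if_convex_concave[OF _ f])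
  have "convex_on I01 (\<lambda>x. - f (1 - x))"
    using f convex_on_reflect[of "\<lambda>x. - f x"] by (simp add: concave_on_def)
  hence g: "convex_on I01 (\<lambda>x. - f (1 - x) + 2 * c)"
    by (intro convex_on_add) (auto simp: convex_on_const)
  \<comment> \<open>The identity is available only on the interval, so convexity is transferred
    pointwise after checking that convex combinations remain inside.\<close>
  have eq: "- f (1 - x) + 2 * c = f x" if "x \<in> I01" for x
    using c[OF that] by (simp add: avg_LR_def p1_def p2_def)
  show "convex_on I01 f"
  proof (rule convex_onI)
    fix t x y :: real
    assume t: "0 < t" "t < 1" and xy: "x \<in> I01" "y \<in> I01"
    have "(1 - t) *\<^sub>R x + t *\<^sub>R y \<in> I01"
      using t xy convex_real_interval(8)[of 0 1] by (intro convexD) auto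
    thus "f ((1 - t) *\<^sub>R x + t *\<^sub>R y) \<le> (1 - t) * f x + t * f y"
      using convex_onD[OF g, of t x y] t xy by (simp only: eq less_imp_le)
  qed (rule convex_real_interval)
qed

text \<open>The exceptional set is open, and a nonempty open set is not null.\<close>

lemma continuous_AE_const:
  fixes g :: "real \<Rightarrow> real"
  assumes A: "open A" "continuous_on A g" and ae: "AE x in lborel. x \<in> A \<longrightarrow> g x = c"
    and x: "x \<in> A"
  shows "g x = c"
proof (rule ccontr)
  assume "g x \<noteq> c"
  define N where "N = {x \<in> A. g x \<noteq> c}"
  have "open N"
  proof -
    have "N = A \<inter> g -` (- {c})"
      by (auto simp: N_def)
    thus ?thesis
      using continuous_open_preimage[OF A(2,1), of "- {c}"] by (simp add: open_Compl)
  qed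
  moreover have "N \<in> null_sets lborel"
    using ae \<open>open N\<close> by (subst AE_iff_null_sets) (auto simp: N_def)
  ultimately have "negligible N" "N \<noteq> {}"
    using x \<open>g x \<noteq> c\<close> by (auto simp: negligible_iff_null_sets N_def intro: null_sets_completionI)
  thus False
    using open_not_negligible[OF \<open>open N\<close>] by simp
qed

text \<open>A concave function is continuous on an open interval. This is what upgrades an almost
  everywhere constant average to a constant one.\<close>

lemma continuous_on_avg_LR:
  assumes "concave_on I01 f"
  shows "continuous_on I01 (avg_LR f)"
proof -
  have f: "continuous_on I01 f"
    using convex_on_continuous[of I01 "\<lambda>x. - f x"] continuous_on_minus[of I01 "\<lambda>x. - f x"] assms
    by (simp add: concave_on_def)
  have "continuous_on I01 (\<lambda>x. f (1 - x))"
    by (rule continuous_on_compose2[OF f]) (auto intro!: continuous_intros)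
  thus ?thesis
    unfolding avg_LR_def[abs_def] p1_def p2_def by (intro continuous_intros f)
qed

text \<open>The negated average turns the maximiser of the Neyman-Pearson lemma into a minimiser.
  The competitor is the constant critical function \<alpha>, whose power is \<alpha> because the
  average integrates to 1.\<close>

lemma rejects_when_avg_LR_small_power:
  assumes dens: "density_on_I01 f" and f: "concave_on I01 f" and \<alpha>: "0 < \<alpha>" "\<alpha> < 1"
    and R: "rejects_when_large_ties \<alpha> (\<lambda>x. - avg_LR f x) R"
  shows "(LINT x:R|lborel. avg_LR f x) \<le> \<alpha>"
    and "\<not> affine_on_I01 f \<Longrightarrow> (LINT x:R|lborel. avg_LR f x) < \<alpha>"
proof -
  let ?T = "\<lambda>x. - avg_LR f x"
  obtain c where c: "\<forall>x\<in>I01. (?T x > c \<longrightarrow> x \<in> R) \<and> (?T x < c \<longrightarrow> x \<notin> R)"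
    using R by (auto simp: rejects_when_large_ties_def)
  have Rl: "level_test \<alpha> R"
    using R by (simp add: rejects_when_large_ties_def)
  note int = set_integrable_avg_LR(3)[OF dens]
  have T: "set_integrable lborel I01 ?T"
    using int by (simp add: set_integrable_def)
  have ge: "c \<le> ?T x" if "x \<in> R" for x
    using c that level_test_measure(1)[OF Rl] by (meson linorder_not_le subsetD)
  have le: "?T x \<le> c" if "x \<in> I01 - R" for x
    using c that by (meson DiffE linorder_not_le)
  have level: "(LINT x:I01|lborel. \<alpha>) = \<alpha>"
    by (simp add: set_lebesgue_integral_def)
  have "(LINT x:I01|lborel. \<alpha> * ?T x) = (LINT x:I01|lborel. (- \<alpha>) * avg_LR f x)"
    by simp
  also have "\<dots> = - \<alpha> * (LINT x:I01|lborel. avg_LR f x)"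
    by (rule set_integral_mult_right)
  finally have e: "(LINT x:I01|lborel. \<alpha> * ?T x) = - \<alpha>"
    using integral_avg_LR[OF dens] by simp
  have e': "(LINT x:R|lborel. ?T x) = - (LINT x:R|lborel. avg_LR f x)"
    by (simp add: set_lebesgue_integral_def)
  note np = neyman_pearson[OF Rl T ge le _ _ level, simplified e e']
  show le_\<alpha>: "(LINT x:R|lborel. avg_LR f x) \<le> \<alpha>"
    using np(1) \<alpha> by simp
  assume "\<not> affine_on_I01 f"
  show "(LINT x:R|lborel. avg_LR f x) < \<alpha>"
  proof (rule ccontr)
    assume "\<not> ?thesis"
    hence "AE x in lborel. x \<in> I01 \<longrightarrow> (indicator R x - \<alpha>) * (?T x - c) = 0"
      using np(2) le_\<alpha> \<alpha> by simp
    \<comment> \<open>The factor \<open>indicator R x - \<alpha>\<close> is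
      \<open>1 - \<alpha>\<close> or \<open>- \<alpha>\<close>, never zero, so the other factor must
      vanish.\<close>
    hence "AE x in lborel. x \<in> I01 \<longrightarrow> avg_LR f x = - c"
      by (rule eventually_mono) (use \<alpha> in \<open>auto simp: indicator_def split: if_splits\<close>)
    hence "avg_LR f x = - c" if "x \<in> I01" for x
      using continuous_AE_const[OF open_greaterThanLessThan continuous_on_avg_LR[OF f] _ that] by simp
    thus False
      using affine_if_avg_LR_const[OF f] \<open>\<not> affine_on_I01 f\<close> by blast
  qed
qed

text \<open>For affine \<open>f\<close> the average is constant: every symmetric test then has power
  exactly \<alpha>, which rules out the strict bound, and a distance test need not be a strict
  threshold region of the average.\<close>

theorem theorem2p2:
  fixes f :: "real \<Rightarrow> real" and \<alpha> :: real
  assumes "density_on_I01 f" and "mono_on {0<..<1} f" and "0 < \<alpha>" and "\<alpha> < 1"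
  shows
    "(convex_on {0<..<1} f \<longrightarrow>
        (\<forall>R. avg_LR_test \<alpha> f R \<longrightarrow> large_distance_test \<alpha> R) \<and>
        (\<forall>R. large_distance_test \<alpha> R \<longrightarrow> avg_LR_test_ties \<alpha> f R))
   \<and> (concave_on {0<..<1} f \<longrightarrow>
        (\<forall>R. avg_LR_test \<alpha> f R \<longrightarrow> small_distance_test \<alpha> R) \<and>
        (\<forall>R. small_distance_test \<alpha> R \<longrightarrow> avg_LR_test_ties \<alpha> f R))
   \<and> (convex_on {0<..<1} f \<longrightarrow>
        (\<forall>R. avg_LR_test \<alpha> f R \<longrightarrow> max_LR_test \<alpha> f R) \<and>
        (\<forall>R. max_LR_test \<alpha> f R \<longrightarrow>
           avg_LR_test_ties \<alpha> f R \<and>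
           most_powerful_symmetric \<alpha> (p1 f) R \<and> most_powerful_symmetric \<alpha> (p2 f) R))
   \<and> (concave_on {0<..<1} f \<longrightarrow>
        (\<forall>R. max_LR_test \<alpha> f R \<longrightarrow>
           least_powerful_symmetric \<alpha> (p1 f) R \<and> least_powerful_symmetric \<alpha> (p2 f) R \<and>
           power_against (p1 f) R \<le> \<alpha> \<and> power_against (p2 f) R \<le> \<alpha> \<and>
           (\<not> affine_on_I01 f \<longrightarrow> power_against (p1 f) R < \<alpha> \<and> power_against (p2 f) R < \<alpha>)))"
proof (intro conjI impI allI)
  note \<alpha> = \<open>0 < \<alpha>\<close> \<open>\<alpha> < 1\<close>
  note dens = assms(1) and mono = assms(2)
  note avg_int = set_integrable_avg_LR(3)[OF dens]
  have max_dist: "\<bar>x - 1/2\<bar> < \<bar>y - 1/2\<bar>" if "x \<in> I01" "y \<in> I01" "max_LR f x < max_LR f y" for x y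
    using max_LR_mono_distance[OF mono that(1,2)] that(3) by force
  {
    fix R assume f: "convex_on {0<..<1} f"
    have dist: "\<bar>x - 1/2\<bar> < \<bar>y - 1/2\<bar>" if "x \<in> I01" "y \<in> I01" "avg_LR f x < avg_LR f y" for x y
      using avg_LR_mono_distance[OF f that(1,2)] that(3) by force
    have avg: "avg_LR f x \<le> avg_LR f y" if "x \<in> I01" "y \<in> I01" "\<bar>x - 1/2\<bar> < \<bar>y - 1/2\<bar>" for x y
      using avg_LR_mono_distance[OF f that(2,1)] that(3) by simp
    show "large_distance_test \<alpha> R" if "avg_LR_test \<alpha> f R"
      unfolding large_distance_test_def
      by (rule rejects_when_large_mono[OF that[unfolded avg_LR_test_def] \<alpha> dist])
    show "avg_LR_test_ties \<alpha> f R" if "large_distance_test \<alpha> R"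
      unfolding avg_LR_test_ties_def
      by (rule rejects_when_large_imp_ties[OF that[unfolded large_distance_test_def] \<alpha> avg])
    show "max_LR_test \<alpha> f R" if "avg_LR_test \<alpha> f R"
      unfolding max_LR_test_def
      by (rule rejects_when_large_mono[OF that[unfolded avg_LR_test_def] \<alpha>
            max_LR_less_if_avg_LR_less[OF f mono]])
    assume R: "max_LR_test \<alpha> f R"
    \<comment> \<open>A larger maximum means a larger distance from the centre, which in turn means
      an average at least as large.\<close>
    show ties: "avg_LR_test_ties \<alpha> f R"
      unfolding avg_LR_test_ties_def
      by (rule rejects_when_large_imp_ties[OF R[unfolded max_LR_test_def] \<alpha> avg[OF _ _ max_dist]])
    note Rs = max_LR_test_symmetric[OF R]
    have "(LINT x:S|lborel. avg_LR f x) \<le> (LINT x:R|lborel. avg_LR f x)" if "level_test \<alpha> S" for S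
      using rejects_when_large_ties_optimal[OF _ avg_int \<alpha> that] ties
      by (simp add: avg_LR_test_ties_def)
    thus "most_powerful_symmetric \<alpha> (p1 f) R" "most_powerful_symmetric \<alpha> (p2 f) R"
      using Rs power_symmetric[OF dens] level_test_measure
      unfolding most_powerful_symmetric_def by metis+
  next
    fix R assume f: "concave_on {0<..<1} f"
    have dist: "\<bar>y - 1/2\<bar> < \<bar>x - 1/2\<bar>" if "x \<in> I01" "y \<in> I01" "avg_LR f x < avg_LR f y" for x y
      using avg_LR_antimono_distance[OF f that(2,1)] that(3) by force
    have avg: "avg_LR f y \<le> avg_LR f x" if "x \<in> I01" "y \<in> I01" "\<bar>x - 1/2\<bar> < \<bar>y - 1/2\<bar>" for x y
      using avg_LR_antimono_distance[OF f that(2,1)] that(3) by simp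
    show "small_distance_test \<alpha> R" if "avg_LR_test \<alpha> f R"
      unfolding small_distance_test_def
      by (rule rejects_when_large_mono[OF that[unfolded avg_LR_test_def] \<alpha>]) (use dist in auto)
    show "avg_LR_test_ties \<alpha> f R" if "small_distance_test \<alpha> R"
      unfolding avg_LR_test_ties_def
      by (rule rejects_when_large_imp_ties[OF that[unfolded small_distance_test_def] \<alpha>])
        (use avg in auto)
    assume R: "max_LR_test \<alpha> f R"
    note Rs = max_LR_test_symmetric[OF R]
    \<comment> \<open>In the concave case a larger distance makes the average smaller or equal, so
      the maximum LR test rejects where the average is small.\<close>
    have ties: "rejects_when_large_ties \<alpha> (\<lambda>x. - avg_LR f x) R"
      by (rule rejects_when_large_imp_ties[OF R[unfolded max_LR_test_def] \<alpha>])
        (use avg max_dist in auto)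
    have "set_integrable lborel I01 (\<lambda>x. - avg_LR f x)"
      using avg_int by (simp add: set_integrable_def)
    hence "(LINT x:R|lborel. avg_LR f x) \<le> (LINT x:S|lborel. avg_LR f x)" if "level_test \<alpha> S" for S
      using rejects_when_large_ties_optimal[OF ties _ \<alpha> that]
      by (simp add: set_lebesgue_integral_def)
    thus "least_powerful_symmetric \<alpha> (p1 f) R" "least_powerful_symmetric \<alpha> (p2 f) R"
      using Rs power_symmetric[OF dens] level_test_measure
      unfolding least_powerful_symmetric_def by metis+
    note pow = power_symmetric[OF dens level_test_measure(1,2)[OF Rs(1)] Rs(2)]
    note bound = rejects_when_avg_LR_small_power[OF dens f \<alpha> ties]
    show "power_against (p1 f) R \<le> \<alpha>" "power_against (p2 f) R \<le> \<alpha>"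
      using bound(1) pow by simp_all
    assume "\<not> affine_on_I01 f"
    thus "power_against (p1 f) R < \<alpha>" "power_against (p2 f) R < \<alpha>"
      using bound(2) pow by simp_all
  }
qed

end
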